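(* The following two assertions are equivalent. (A) For every non-empty compact convex subset $X$ of a Hausdorff topological vector space and every function $f:X\times X\to\mathbb{R}$ such that (i) for each $y\in X$, $f(\cdot,y)$ is lower semicontinuous, and (ii) for each $x\in X$, $f(x,\cdot)$ is quasi-concave, one has \[ \min_{x\in X}\sup_{y\in X} f(x,y)\leq \sup_{x\in X} f(x,x). \] (B) For every non-empty compact convex subset $X$ of a Hausdorff topological vector space and every function $f:X\times X\to\mathbb{R}$ such that (i) $f$ is pseudo-continuous on $X\times X$, and (ii) for each $x\in X$, $f(x,\cdot)$ is quasi-concave, one has \[ \min_{x\in X}\max_{y\in X} f(x,y)\leq \max_{x\in X} f(x,x). \]
   Context: Vector spaces are real. Assertion (A) is Ky Fan's minimax inequality; suprema are taken in $\mathbb{R}\cup\{+\infty\}$. A function $f:Z\to\mathbb{R}$ on a topological space $Z$ is upper pseudo-continuous if for all $x,y\in Z$ with $f(x)<f(y)$ there is a neighbourhood $V$ of $x$ with $f(x')<f(y)$ for all $x'\in V$. It is lower pseudo-continuous if $-f$ is upper pseudo-continuous, and pseudo-continuous if it is both. A function $g:X\to\mathbb{R}$ on a convex set $X$ is quasi-concave if $\{x\in X: g(x)\geq\lambda\}$ is convex for every $\lambda\in\mathbb{R}$. *)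

theory Defs
  imports "HOL-Analysis.Analysis"
begin

(* A topological vector space is a topology T, unrelated to any type-class topology,
   whose underlying set is a linear subspace of a type of class real_vector.
   Up to linear isomorphism, these subspaces are all the real vector spaces whose
   dimension is at most that of the type, so that quantifying over T quantifies over the
   vector space as well as over its topology.  Separation is not part of the definition. *)
definition topological_vector_space :: "'a::real_vector topology \<Rightarrow> bool" where
  "topological_vector_space T \<longleftrightarrow>
     subspace (topspace T) \<and>
     continuous_map (prod_topology T T) T (\<lambda>(x, y). x + y) \<and>
     continuous_map (prod_topology euclideanreal T) T (\<lambda>(c, x). c *\<^sub>R x)"

definition lower_semicontinuous :: "'z topology \<Rightarrow> ('z \<Rightarrow> real) \<Rightarrow> bool" where
  "lower_semicontinuous Z f \<longleftrightarrow>
     (\<forall>x\<in>topspace Z. \<forall>a. a < f x \<longrightarrow>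
        (\<exists>V. openin Z V \<and> x \<in> V \<and> (\<forall>x'\<in>V. a < f x')))"

definition upper_pseudo_continuous :: "'z topology \<Rightarrow> ('z \<Rightarrow> real) \<Rightarrow> bool" where
  "upper_pseudo_continuous Z f \<longleftrightarrow>
     (\<forall>x\<in>topspace Z. \<forall>y\<in>topspace Z. f x < f y \<longrightarrow>
        (\<exists>V. openin Z V \<and> x \<in> V \<and> (\<forall>x'\<in>V. f x' < f y)))"

definition lower_pseudo_continuous :: "'z topology \<Rightarrow> ('z \<Rightarrow> real) \<Rightarrow> bool" where
  "lower_pseudo_continuous Z f \<longleftrightarrow> upper_pseudo_continuous Z (\<lambda>x. - f x)"

definition pseudo_continuous :: "'z topology \<Rightarrow> ('z \<Rightarrow> real) \<Rightarrow> bool" where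
  "pseudo_continuous Z f \<longleftrightarrow> upper_pseudo_continuous Z f \<and> lower_pseudo_continuous Z f"

definition quasi_concave_on :: "'a::real_vector set \<Rightarrow> ('a \<Rightarrow> real) \<Rightarrow> bool" where
  "quasi_concave_on X g \<longleftrightarrow> convex X \<and> (\<forall>l. convex {x \<in> X. g x \<ge> l})"

(* Attained extrema over sets that may be infinite, where Min and Max are unspecified. *)
definition is_min_of :: "'c::linorder \<Rightarrow> ('b \<Rightarrow> 'c) \<Rightarrow> 'b set \<Rightarrow> bool" where
  "is_min_of m g S \<longleftrightarrow> m \<in> g ` S \<and> (\<forall>x\<in>S. m \<le> g x)"

definition is_max_of :: "'c::linorder \<Rightarrow> ('b \<Rightarrow> 'c) \<Rightarrow> 'b set \<Rightarrow> bool" where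
  "is_max_of m g S \<longleftrightarrow> m \<in> g ` S \<and> (\<forall>x\<in>S. g x \<le> m)"

end

theory Submission
  imports Defs
begin

text \<open>
  Both directions construct, from a function of one kind, a function of the other kind.

  From (A) to (B): let \<open>d\<close> be the maximum of \<open>f\<close> on the diagonal.  Pseudo-continuity gives
  neighbourhoods only at levels that are values of \<open>f\<close>, and \<open>d\<close> is such a value.  So the set
  where \<open>f > d\<close> is open, and its indicator function \<open>g\<close> is lower semicontinuous in \<open>x\<close>; it is
  quasi-concave in \<open>y\<close> and vanishes on the diagonal.  Assertion (A) for \<open>g\<close> then says that some
  \<open>x\<close> satisfies \<open>f x y \<le> d\<close> for all \<open>y\<close>.  That the extrema in (B) are attained follows from
  the fact that the levels relevant to compactness arguments are values of \<open>f\<close> as well.  This is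
  \<open>pseudo_continuous_minimax\<close>.

  From (B) to (A): applied to \<open>- norm (y - p x)\<close> on a polytope, (B) implies Brouwer's fixed
  point theorem (\<open>polytope_fixed_point\<close>).  A fixed point of a map glued by a partition of unity
  then refutes any violation of Ky Fan's inequality (\<open>ky_fan_inequality\<close>).  As (B) is used
  for a topology different from the given one, the two assertions are compared as
  statements about all topologies on subspaces of one vector space, not for a single topology.
\<close>

section \<open>Extrema on compact spaces\<close>

text \<open>The condition asks for a neighbourhood only at levels \<open>M x'\<close> that are themselves values.
  This weak form of lower semicontinuity still suffices: if there were no least value, the sets
  \<open>{v. M x' < M v}\<close> would cover the space, and the least of the finitely many levels of a
  subcover would lie above another one of these levels.\<close>

lemma compact_space_attains_least:
  fixes M :: "'z \<Rightarrow> 'c::linorder"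
  assumes "compact_space Z" and "topspace Z \<noteq> {}"
    and nbhd: "\<And>x x'. \<lbrakk>x \<in> topspace Z; x' \<in> topspace Z; M x' < M x\<rbrakk> \<Longrightarrow>
                 \<exists>V. openin Z V \<and> x \<in> V \<and> (\<forall>v\<in>V. M x' < M v)"
  shows "\<exists>x\<in>topspace Z. \<forall>x'\<in>topspace Z. M x \<le> M x'"
proof (rule ccontr)
  assume "\<not> ?thesis"
  then have smaller: "\<And>x. x \<in> topspace Z \<Longrightarrow> \<exists>x'\<in>topspace Z. M x' < M x"
    by (metis not_le)
  define \<U> where "\<U> = {V. openin Z V \<and> (\<exists>x'\<in>topspace Z. \<forall>v\<in>V. M x' < M v)}"
  have "\<forall>U\<in>\<U>. openin Z U"
    unfolding \<U>_def by simp
  moreover have "topspace Z \<subseteq> \<Union>\<U>"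
  proof
    fix x assume x: "x \<in> topspace Z"
    obtain x' where x': "x' \<in> topspace Z" "M x' < M x" using smaller[OF x] by blast
    then obtain V where "openin Z V" "x \<in> V" "\<forall>v\<in>V. M x' < M v" using nbhd[OF x x'] by blast
    then show "x \<in> \<Union>\<U>" unfolding \<U>_def using x'(1) by blast
  qed
  ultimately obtain \<F> where \<F>: "finite \<F>" "\<F> \<subseteq> \<U>" "topspace Z \<subseteq> \<Union>\<F>"
    using assms(1) unfolding compact_space_alt by meson
  then have "\<forall>V\<in>\<F>. \<exists>x'. x' \<in> topspace Z \<and> (\<forall>v\<in>V. M x' < M v)"
    unfolding \<U>_def by blast
  from bchoice[OF this] obtain c where
    c: "\<And>V. V \<in> \<F> \<Longrightarrow> c V \<in> topspace Z" "\<And>V v. V \<in> \<F> \<Longrightarrow> v \<in> V \<Longrightarrow> M (c V) < M v"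
    by blast
  have "\<F> \<noteq> {}" using \<F>(3) assms(2) by auto
  define least where "least = Min ((\<lambda>V. M (c V)) ` \<F>)"
  have "least \<in> (\<lambda>V. M (c V)) ` \<F>"
    unfolding least_def using \<F>(1) \<open>\<F> \<noteq> {}\<close> by (intro Min_in) simp_all
  then obtain V where V: "V \<in> \<F>" "M (c V) = least" by blast
  with c(1) \<F>(3) obtain W where W: "W \<in> \<F>" "c V \<in> W" by blast
  have "least \<le> M (c W)"
    unfolding least_def using \<F>(1) W(1) by simp
  also have "\<dots> < least"
    using c(2)[OF W] V(2) by simp
  finally show False by simp
qed

lemma upper_pseudo_continuous_compose:
  assumes F: "upper_pseudo_continuous Z F" and h: "continuous_map W Z h"
  shows "upper_pseudo_continuous W (\<lambda>x. F (h x))"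
  unfolding upper_pseudo_continuous_def
proof (intro ballI impI)
  fix x y assume xy: "x \<in> topspace W" "y \<in> topspace W" "F (h x) < F (h y)"
  then have "h x \<in> topspace Z" "h y \<in> topspace Z"
    using continuous_map_funspace[OF h] by auto
  then obtain V where V: "openin Z V" "h x \<in> V" "\<And>v. v \<in> V \<Longrightarrow> F v < F (h y)"
    using F[unfolded upper_pseudo_continuous_def, rule_format, of "h x" "h y"] xy(3) by auto
  then show "\<exists>V. openin W V \<and> x \<in> V \<and> (\<forall>x'\<in>V. F (h x') < F (h y))"
    using openin_continuous_map_preimage[OF h V(1)] xy(1)
    by (intro exI[of _ "{x \<in> topspace W. h x \<in> V}"]) auto
qed

lemma pseudo_continuous_compose:
  "pseudo_continuous Z F \<Longrightarrow> continuous_map W Z h \<Longrightarrow> pseudo_continuous W (\<lambda>x. F (h x))"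
  unfolding pseudo_continuous_def lower_pseudo_continuous_def
  using upper_pseudo_continuous_compose by blast

lemma lower_pseudo_continuousD:
  assumes "pseudo_continuous Z F" "x \<in> topspace Z" "y \<in> topspace Z" "F y < F x"
  shows "\<exists>V. openin Z V \<and> x \<in> V \<and> (\<forall>v\<in>V. F y < F v)"
  using assms unfolding pseudo_continuous_def lower_pseudo_continuous_def upper_pseudo_continuous_def
  by simp

lemma pseudo_continuous_attains_max:
  assumes "pseudo_continuous Z F" "compact_space Z" "topspace Z \<noteq> {}"
  shows "\<exists>M. is_max_of M F (topspace Z)"
proof -
  have "\<exists>x\<in>topspace Z. \<forall>x'\<in>topspace Z. - F x \<le> - F x'"
    using assms unfolding pseudo_continuous_def upper_pseudo_continuous_def
    by (intro compact_space_attains_least) auto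
  then obtain x where "x \<in> topspace Z" "\<forall>x'\<in>topspace Z. F x' \<le> F x" by auto
  then have "is_max_of (F x) F (topspace Z)"
    unfolding is_max_of_def by blast
  then show ?thesis ..
qed

lemma continuous_imp_upper_pseudo_continuous:
  assumes "continuous_map Z euclideanreal F"
  shows "upper_pseudo_continuous Z F"
  unfolding upper_pseudo_continuous_def
proof (intro ballI impI)
  fix x y assume xy: "x \<in> topspace Z" "y \<in> topspace Z" "F x < F y"
  have "openin Z {z \<in> topspace Z. F z \<in> {..<F y}}"
    using openin_continuous_map_preimage[OF assms, of "{..<F y}"] by simp
  with xy show "\<exists>V. openin Z V \<and> x \<in> V \<and> (\<forall>x'\<in>V. F x' < F y)"
    by (intro exI[of _ "{z \<in> topspace Z. F z \<in> {..<F y}}"]) simp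
qed

lemma continuous_imp_pseudo_continuous:
  "continuous_map Z euclideanreal F \<Longrightarrow> pseudo_continuous Z F"
  unfolding pseudo_continuous_def lower_pseudo_continuous_def
  by (intro conjI continuous_imp_upper_pseudo_continuous continuous_map_minus)

lemma convex_strict_superlevel:
  assumes "quasi_concave_on X g"
  shows "convex {x \<in> X. a < g x}"
proof (rule convexI)
  fix x y and u v :: real
  assume xy: "x \<in> {x \<in> X. a < g x}" "y \<in> {x \<in> X. a < g x}" and uv: "0 \<le> u" "0 \<le> v" "u + v = 1"
  have "convex {z \<in> X. min (g x) (g y) \<le> g z}"
    using assms unfolding quasi_concave_on_def by simp
  then have "u *\<^sub>R x + v *\<^sub>R y \<in> {z \<in> X. min (g x) (g y) \<le> g z}"
    using xy uv by (intro convexD) simp_all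
  then show "u *\<^sub>R x + v *\<^sub>R y \<in> {x \<in> X. a < g x}"
    using xy by auto
qed

section \<open>From Ky Fan's inequality to pseudo-continuous functions\<close>

text \<open>Joint pseudo-continuity matters here: the level \<open>f a b\<close> in \<open>open_above\<close> is a value at an
  arbitrary point of the square, on which the separate functions \<open>f(\<cdot>, y)\<close> give no information.
  It is used twice, with \<open>f a b\<close> a value of the row maximum \<open>M\<close> to minimise \<open>M\<close>, and with
  \<open>f a b\<close> the diagonal maximum \<open>d\<close> to obtain lower semicontinuity of the indicator of \<open>f > d\<close>.\<close>

lemma pseudo_continuous_minimax:
  fixes f :: "'a::real_vector \<Rightarrow> 'a \<Rightarrow> real"
  assumes ky_fan: "\<And>g :: 'a \<Rightarrow> 'a \<Rightarrow> real.
        \<lbrakk>\<forall>y\<in>X. lower_semicontinuous (subtopology T X) (\<lambda>x. g x y);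
         \<forall>x\<in>X. quasi_concave_on X (\<lambda>y. g x y)\<rbrakk> \<Longrightarrow>
        \<exists>m. is_min_of m (\<lambda>x. SUP y\<in>X. ereal (g x y)) X \<and> m \<le> (SUP x\<in>X. ereal (g x x))"
    and X: "X \<noteq> {}" "compactin T X"
    and f: "pseudo_continuous (prod_topology (subtopology T X) (subtopology T X)) (\<lambda>(x, y). f x y)"
    and qc: "\<forall>x\<in>X. quasi_concave_on X (\<lambda>y. f x y)"
  shows "\<exists>M m d. (\<forall>x\<in>X. is_max_of (M x) (\<lambda>y. f x y) X) \<and> is_min_of m M X \<and>
                 is_max_of d (\<lambda>x. f x x) X \<and> m \<le> d"
proof -
  define Z where "Z = subtopology T X"
  have Z: "topspace Z = X" "compact_space Z"
    using X(2) compactin_subset_topspace unfolding Z_def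
    by (fastforce, simp add: compact_space_subtopology)
  have row: "continuous_map Z (prod_topology Z Z) (\<lambda>y. (x, y))"
    and column: "continuous_map Z (prod_topology Z Z) (\<lambda>y. (y, x))" if "x \<in> X" for x
    using that Z(1) by (auto intro!: continuous_intros)
  have diagonal: "continuous_map Z (prod_topology Z Z) (\<lambda>x. (x, x))"
    by (auto intro!: continuous_intros)
  have f': "pseudo_continuous (prod_topology Z Z) (\<lambda>(x, y). f x y)"
    using f Z_def by simp
  have "\<forall>x\<in>X. \<exists>M. is_max_of M (\<lambda>y. f x y) X"
    using pseudo_continuous_attains_max[OF pseudo_continuous_compose[OF f' row]] Z X(1) by auto
  then obtain M where M: "\<And>x. x \<in> X \<Longrightarrow> is_max_of (M x) (\<lambda>y. f x y) X"
    by metis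
  obtain d where d: "is_max_of d (\<lambda>x. f x x) X"
    using pseudo_continuous_attains_max[OF pseudo_continuous_compose[OF f' diagonal]] Z X(1) by auto
  have open_above: "\<exists>V. openin Z V \<and> x \<in> V \<and> (\<forall>v\<in>V. f a b < f v y)"
    if xy: "x \<in> X" "y \<in> X" and ab: "a \<in> X" "b \<in> X" and less: "f a b < f x y" for x y a b
  proof -
    obtain V where V: "openin (prod_topology Z Z) V" "(x, y) \<in> V" "\<And>v. v \<in> V \<Longrightarrow> f a b < f (fst v) (snd v)"
      using lower_pseudo_continuousD[OF f', of "(x, y)" "(a, b)"] xy ab less Z(1) by force
    have "openin Z {v \<in> topspace Z. (v, y) \<in> V}"
      by (rule openin_continuous_map_preimage[OF column[OF xy(2)] V(1)])
    then show ?thesis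
      using V xy Z(1) by (intro exI[of _ "{v \<in> topspace Z. (v, y) \<in> V}"]) force
  qed
  have "\<exists>x\<in>topspace Z. \<forall>x'\<in>topspace Z. M x \<le> M x'"
  proof (rule compact_space_attains_least)
    fix x a assume xa: "x \<in> topspace Z" "a \<in> topspace Z" "M a < M x"
    then obtain y b where yb: "y \<in> X" "b \<in> X" "M x = f x y" "M a = f a b"
      using M Z(1) unfolding is_max_of_def by (metis imageE)
    then obtain V where "openin Z V" "x \<in> V" "\<And>v. v \<in> V \<Longrightarrow> f a b < f v y"
      using open_above[of x y a b] xa Z(1) by auto
    moreover have "f v y \<le> M v" if "v \<in> V" for v
      using M[of v] yb(1) that openin_subset[OF \<open>openin Z V\<close>] Z(1) unfolding is_max_of_def by auto
    ultimately show "\<exists>V. openin Z V \<and> x \<in> V \<and> (\<forall>v\<in>V. M a < M v)"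
      using yb(4) by (metis less_le_trans)
  qed (use Z X in auto)
  then obtain x0 where x0: "x0 \<in> X" "\<And>x. x \<in> X \<Longrightarrow> M x0 \<le> M x"
    using Z(1) by auto
  obtain c where c: "c \<in> X" "d = f c c"
    using d unfolding is_max_of_def by auto
  define g :: "'a \<Rightarrow> 'a \<Rightarrow> real" where "g x y = (if d < f x y then 1 else 0)" for x y
  have "lower_semicontinuous Z (\<lambda>x. g x y)" if y: "y \<in> X" for y
    unfolding lower_semicontinuous_def
  proof (intro ballI allI impI)
    fix x a assume x: "x \<in> topspace Z" "a < g x y"
    show "\<exists>V. openin Z V \<and> x \<in> V \<and> (\<forall>x'\<in>V. a < g x' y)"
    proof (cases "d < f x y")
      case True
      then obtain V where "openin Z V" "x \<in> V" "\<And>v. v \<in> V \<Longrightarrow> d < f v y"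
        using open_above[of x y c c] c x(1) y Z(1) by auto
      then show ?thesis
        using x True unfolding g_def by auto
    next
      case False
      then have "a < g v y" for v
        using x(2) unfolding g_def by auto
      then show ?thesis
        using x(1) by blast
    qed
  qed
  moreover have "quasi_concave_on X (\<lambda>y. g x y)" if x: "x \<in> X" for x
    unfolding quasi_concave_on_def
  proof (intro conjI allI)
    show X_convex: "convex X" using qc x unfolding quasi_concave_on_def by blast
    fix l
    have "{y \<in> X. l \<le> g x y} = (if l \<le> 0 then X else if l \<le> 1 then {y \<in> X. d < f x y} else {})"
      unfolding g_def by auto
    then show "convex {y \<in> X. l \<le> g x y}"
      using X_convex convex_strict_superlevel[OF qc[rule_format, OF x], of d] by simp
  qed
  ultimately obtain m where m: "is_min_of m (\<lambda>x. SUP y\<in>X. ereal (g x y)) X"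
      "m \<le> (SUP x\<in>X. ereal (g x x))"
    using ky_fan unfolding Z_def by blast
  have "g x x = 0" if "x \<in> X" for x
    using d that unfolding g_def is_max_of_def by force
  then have "m \<le> 0"
    using m(2) X(1) by (simp add: zero_ereal_def)
  then obtain x1 where x1: "x1 \<in> X" "(SUP y\<in>X. ereal (g x1 y)) \<le> 0"
    using m(1) unfolding is_min_of_def by auto
  have "f x1 y \<le> d" if "y \<in> X" for y
  proof -
    have "ereal (g x1 y) \<le> 0"
      by (rule order_trans[OF SUP_upper[OF that] x1(2)])
    then show ?thesis unfolding g_def by (auto split: if_splits)
  qed
  then have "M x1 \<le> d"
    using M[OF x1(1)] unfolding is_max_of_def by auto
  then have "M x0 \<le> d"
    using x0(2)[OF x1(1)] by simp
  moreover have "is_min_of (M x0) M X"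
    using x0 unfolding is_min_of_def by auto
  ultimately show ?thesis
    using M d by blast
qed

section \<open>Coordinate topologies and polytopes\<close>

lemma topological_vector_space_add:
  assumes "topological_vector_space T" "continuous_map Z T f" "continuous_map Z T g"
  shows "continuous_map Z T (\<lambda>z. f z + g z)"
proof -
  have "continuous_map (prod_topology T T) T (\<lambda>(x, y). x + y)"
    using assms(1) unfolding topological_vector_space_def by simp
  from continuous_map_compose[OF continuous_map_pairedI[OF assms(2,3)] this]
  show ?thesis by (simp add: o_def)
qed

lemma topological_vector_space_scaleR:
  assumes "topological_vector_space T" "continuous_map Z euclideanreal u" "continuous_map Z T g"
  shows "continuous_map Z T (\<lambda>z. u z *\<^sub>R g z)"
proof -
  have "continuous_map (prod_topology euclideanreal T) T (\<lambda>(c, x). c *\<^sub>R x)"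
    using assms(1) unfolding topological_vector_space_def by simp
  from continuous_map_compose[OF continuous_map_pairedI[OF assms(2,3)] this]
  show ?thesis by (simp add: o_def)
qed

text \<open>Adding a vertex \<open>a\<close> to a polytope gives the join of \<open>a\<close> with it, which is a continuous
  image of the product of the unit interval and the old polytope.  Hence compactness follows
  by induction on the number of vertices, in every vector space topology.\<close>

lemma compactin_convex_hull_finite:
  fixes T :: "'a::real_vector topology"
  assumes T: "topological_vector_space T" and "finite S" "S \<subseteq> topspace T"
  shows "compactin T (convex hull S)"
  using assms(2,3)
proof (induction rule: finite_induct)
  case empty
  then show ?case by simp
next
  case (insert a S)
  show ?case
  proof (cases "S = {}")
    case True
    then show ?thesis using insert by simp
  next
    case False
    define P where "P = prod_topology euclideanreal T"
    define h where "h = (\<lambda>(u, b). u *\<^sub>R a + (1 - u) *\<^sub>R b :: 'a)"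
    have fst: "continuous_map P euclideanreal fst" and snd: "continuous_map P T snd"
      unfolding P_def by (auto intro: continuous_map_fst continuous_map_snd)
    have "continuous_map P T (\<lambda>p. fst p *\<^sub>R a + (1 - fst p) *\<^sub>R snd p)"
      using insert.prems
      by (intro topological_vector_space_add[OF T] topological_vector_space_scaleR[OF T]
          continuous_map_diff fst snd) simp_all
    then have "continuous_map P T h"
      unfolding h_def by (simp add: case_prod_unfold)
    moreover have "compactin P ({0..1} \<times> (convex hull S))"
      unfolding P_def using insert by (simp add: compactin_Times)
    ultimately have "compactin T (h ` ({0..1} \<times> (convex hull S)))"
      by (rule image_compactin[rotated])
    moreover have "h ` ({0..1} \<times> (convex hull S)) = convex hull (insert a S)"
      unfolding convex_hull_insert[OF False] h_def
    proof (intro set_eqI iffI; clarsimp)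
      fix u :: real and b assume "0 \<le> u" "u \<le> 1" "b \<in> convex hull S"
      then show "\<exists>ua\<ge>0. \<exists>v\<ge>0. ua + v = 1 \<and> (\<exists>ba. ba \<in> convex hull S \<and>
          u *\<^sub>R a + (1 - u) *\<^sub>R b = ua *\<^sub>R a + v *\<^sub>R ba)"
        by (intro exI[of _ u] conjI exI[of _ "1 - u"]) auto
    next
      fix u v b assume "0 \<le> u" "0 \<le> (v::real)" "u + v = 1" "b \<in> convex hull S"
      then show "u *\<^sub>R a + v *\<^sub>R b \<in> (\<lambda>(u, b). u *\<^sub>R a + (1 - u) *\<^sub>R b) ` ({0..1} \<times> (convex hull S))"
        using eq_diff_eq[of v 1 u] by (intro image_eqI[of _ _ "(u, b)"]) (auto simp: add.commute)
    qed
    ultimately show ?thesis by simp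
  qed
qed

text \<open>The coarsest topology on \<open>S\<close> that makes all functionals in the family \<open>L\<close> continuous.
  For coordinates on a finite-dimensional space \<open>S\<close> it is the Euclidean topology.\<close>

definition coordinate_topology :: "'a set \<Rightarrow> ('b \<Rightarrow> 'a \<Rightarrow> real) \<Rightarrow> 'a topology" where
  "coordinate_topology S L = pullback_topology S (\<lambda>v b. L b v) (powertop_real UNIV)"

lemma topspace_coordinate_topology [simp]: "topspace (coordinate_topology S L) = S"
  unfolding coordinate_topology_def by (simp add: topspace_pullback_topology)

lemma continuous_map_coordinate: "continuous_map (coordinate_topology S L) euclideanreal (L b)"
proof -
  have "continuous_map (powertop_real UNIV) euclideanreal (\<lambda>v. v b)"
    by (rule continuous_map_product_projection) simp
  from continuous_map_pullback[OF this, of S "\<lambda>v b. L b v"] show ?thesis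
    unfolding coordinate_topology_def by (simp add: o_def)
qed

lemma continuous_map_into_coordinate_topology:
  assumes "\<And>b. continuous_map Z euclideanreal (\<lambda>z. L b (h z))" "h ` topspace Z \<subseteq> S"
  shows "continuous_map Z (coordinate_topology S L) h"
  unfolding coordinate_topology_def
  by (rule continuous_map_pullback') (use assms in \<open>auto simp: o_def continuous_map_componentwise_UNIV\<close>)

lemma topological_vector_space_coordinate_topology:
  fixes L :: "'b \<Rightarrow> 'a::real_vector \<Rightarrow> real"
  assumes S: "subspace S" and L: "\<And>b. linear (L b)"
  shows "topological_vector_space (coordinate_topology S L)"
proof -
  let ?T = "coordinate_topology S L"
  have cont: "continuous_map (prod_topology Y ?T) euclideanreal (\<lambda>z. L b (snd z))"
             "continuous_map (prod_topology ?T Y) euclideanreal (\<lambda>z. L b (fst z))" for b and Y :: "'c topology"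
    using continuous_map_compose[OF continuous_map_snd continuous_map_coordinate, of Y S L b]
      continuous_map_compose[OF continuous_map_fst continuous_map_coordinate, of S L Y b]
    by (simp_all add: o_def)
  have "continuous_map (prod_topology ?T ?T) ?T (\<lambda>z. fst z + snd z)"
    using S by (intro continuous_map_into_coordinate_topology)
      (auto simp: linear_add[OF L] subspace_add intro!: continuous_map_add cont)
  moreover have "continuous_map (prod_topology euclideanreal ?T) ?T (\<lambda>z. fst z *\<^sub>R snd z)"
    using S by (intro continuous_map_into_coordinate_topology)
      (auto simp: linear_scale[OF L] subspace_scale intro!: continuous_map_real_mult cont continuous_map_fst)
  ultimately show ?thesis
    unfolding topological_vector_space_def using S by (simp add: case_prod_unfold)
qed

lemma Hausdorff_space_coordinate_topology:
  assumes "\<And>u v. \<lbrakk>u \<in> S; v \<in> S; \<And>b. L b u = L b v\<rbrakk> \<Longrightarrow> u = v"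
  shows "Hausdorff_space (coordinate_topology S L)"
proof (rule Hausdorff_space_injective_preimage)
  show "Hausdorff_space (powertop_real (UNIV :: 'b set))"
    by (simp add: Hausdorff_space_product_topology)
  show "continuous_map (coordinate_topology S L) (powertop_real UNIV) (\<lambda>v b. L b v)"
    by (simp add: continuous_map_componentwise_UNIV continuous_map_coordinate)
  show "inj_on (\<lambda>v b. L b v) (topspace (coordinate_topology S L))"
    using assms by (auto simp: inj_on_def fun_eq_iff)
qed

text \<open>On a finite-dimensional space this makes the coordinate topology finer than any other vector
  space topology: a vector is the combination of the basis with its coordinates as coefficients.\<close>

lemma continuous_map_linear_combination:
  fixes T :: "'a::real_vector topology"
  assumes T: "topological_vector_space T" and "finite B" "B \<subseteq> topspace T"
    and u: "\<And>b. b \<in> B \<Longrightarrow> continuous_map Z euclideanreal (u b)"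
  shows "continuous_map Z T (\<lambda>z. \<Sum>b\<in>B. u b z *\<^sub>R b)"
  using assms(2,3) u
proof (induction rule: finite_induct)
  case empty
  then show ?case
    using T subspace_0 unfolding topological_vector_space_def by auto
next
  case (insert b B)
  have "continuous_map Z T (\<lambda>z. u b z *\<^sub>R b + (\<Sum>b\<in>B. u b z *\<^sub>R b))"
    using insert by (intro topological_vector_space_add[OF T] topological_vector_space_scaleR[OF T]) simp_all
  then show ?case using insert.hyps by simp
qed

text \<open>The coordinate functionals are linear on the whole space and not only on the span of \<open>Y\<close>,
  so that no membership conditions arise in computations with them.\<close>

lemma linear_coordinates:
  fixes Y :: "'a::real_vector set"
  assumes "finite Y"
  obtains B L where "finite B" "B \<subseteq> Y" "\<And>b. linear (L b)"
    "\<And>v. v \<in> span Y \<Longrightarrow> (\<Sum>b\<in>B. L b v *\<^sub>R b) = v"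
proof -
  obtain B where B: "B \<subseteq> Y" "independent B" "Y \<subseteq> span B"
    using maximal_independent_subset by blast
  then have fin: "finite B" using assms finite_subset by blast
  have "\<forall>b. \<exists>l. linear l \<and> (\<forall>x\<in>B. l x = (if x = b then 1 else 0 :: real))"
    by (intro allI linear_independent_extend[OF B(2)])
  from choice[OF this] obtain L where
    "\<forall>b. linear (L b) \<and> (\<forall>x\<in>B. L b x = (if x = b then 1 else 0 :: real))" ..
  then have L: "\<And>b. linear (L b)" "\<And>b x. x \<in> B \<Longrightarrow> L b x = (if x = b then 1 else 0 :: real)"
    by simp_all
  have "(\<Sum>b\<in>B. L b v *\<^sub>R b) = v" if "v \<in> span Y" for v
  proof -
    have "v \<in> span B" using that span_minimal[OF B(3) subspace_span] by blast
    then obtain u where u: "v = (\<Sum>b\<in>B. u b *\<^sub>R b)"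
      using span_finite[OF fin] by auto
    have "L b v = u b" if b: "b \<in> B" for b
    proof -
      have "L b v = (\<Sum>x\<in>B. u x * L b x)"
        unfolding u by (simp add: linear_sum[OF L(1)] linear_scale[OF L(1)])
      also have "\<dots> = (\<Sum>x\<in>B. if x = b then u x else 0)"
        by (intro sum.cong) (simp_all add: L(2))
      also have "\<dots> = u b" using b fin by simp
      finally show ?thesis .
    qed
    then have "(\<Sum>b\<in>B. L b v *\<^sub>R b) = (\<Sum>b\<in>B. u b *\<^sub>R b)"
      by (intro sum.cong) simp_all
    then show ?thesis using u by simp
  qed
  then show ?thesis by (rule that[OF fin B(1) L(1)])
qed

section \<open>Fixed points from the minimax inequality\<close>

text \<open>This is Brouwer's theorem for maps \<open>p\<close> of a polytope \<open>K\<close> into itself, written in terms of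
  the coefficients of \<open>p x\<close>.  For a norm, the function \<open>g x y = - norm (y - p x)\<close> is continuous,
  concave in \<open>y\<close>, and its maximum over \<open>y\<close> is \<open>0\<close>, attained at \<open>p x\<close>.  The minimax inequality
  therefore gives a point with \<open>0 \<le> g x x\<close>, that is \<open>x = p x\<close>.

  The given topology need not come with a norm.  The inequality is applied in the coordinate
  topology on the span of \<open>K\<close> instead, with the sum of the absolute values of the coordinates as norm.
  The coefficients stay continuous there because this topology is finer than the given one.\<close>

lemma polytope_fixed_point:
  fixes T :: "'a::real_vector topology" and c :: "'i \<Rightarrow> 'a"
  assumes minimax: "\<And>(T :: 'a topology) X f.
      \<lbrakk>topological_vector_space T; Hausdorff_space T; X \<noteq> {}; compactin T X; convex X;
       pseudo_continuous (prod_topology (subtopology T X) (subtopology T X)) (\<lambda>(x, y). f x y);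
       \<forall>x\<in>X. quasi_concave_on X (\<lambda>y. f x y)\<rbrakk> \<Longrightarrow>
      \<exists>M m d. (\<forall>x\<in>X. is_max_of (M x) (\<lambda>y. f x y) X) \<and> is_min_of m M X \<and>
              is_max_of d (\<lambda>x. f x x) X \<and> m \<le> (d::real)"
    and T: "topological_vector_space T" and I: "finite I" "I \<noteq> {}" "c ` I \<subseteq> topspace T"
    and K: "K = convex hull (c ` I)"
    and w: "\<And>i. i \<in> I \<Longrightarrow> continuous_map (subtopology T K) euclideanreal (w i)"
      "\<And>i x. \<lbrakk>i \<in> I; x \<in> K\<rbrakk> \<Longrightarrow> 0 \<le> w i x"
      "\<And>x. x \<in> K \<Longrightarrow> (\<Sum>i\<in>I. w i x) = 1"
  shows "\<exists>x\<in>K. x = (\<Sum>i\<in>I. w i x *\<^sub>R c i)"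
proof -
  define S where "S = span (c ` I)"
  obtain B L where B: "finite B" "B \<subseteq> c ` I" and L: "\<And>b. linear (L b)"
      "\<And>v. v \<in> S \<Longrightarrow> (\<Sum>b\<in>B. L b v *\<^sub>R b) = v"
    unfolding S_def by (rule linear_coordinates[OF finite_imageI[OF I(1), of c]]) blast
  define T' where "T' = coordinate_topology S L"
  have T': "topological_vector_space T'"
    unfolding T'_def S_def by (intro topological_vector_space_coordinate_topology L subspace_span)
  have "Hausdorff_space T'"
    unfolding T'_def
  proof (rule Hausdorff_space_coordinate_topology)
    fix u v assume uv: "u \<in> S" "v \<in> S" "\<And>b. L b u = L b v"
    then have "(\<Sum>b\<in>B. L b u *\<^sub>R b) = (\<Sum>b\<in>B. L b v *\<^sub>R b)" by simp
    then show "u = v" using L(2) uv(1,2) by simp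
  qed
  have cS: "c i \<in> S" if "i \<in> I" for i
    using that unfolding S_def by (simp add: span_base)
  have KS: "K \<subseteq> S"
    unfolding K S_def by (rule convex_hull_subset_span)
  have "compactin T' K"
    unfolding K using I(1) cS by (intro compactin_convex_hull_finite T') (auto simp: T'_def)
  define Z where "Z = subtopology T' K"
  have Z: "topspace Z = K"
    unfolding Z_def T'_def using KS by auto
  have LZ: "continuous_map Z euclideanreal (L b)" for b
    unfolding Z_def T'_def by (intro continuous_map_from_subtopology continuous_map_coordinate)
  have "continuous_map Z T (\<lambda>v. \<Sum>b\<in>B. L b v *\<^sub>R b)"
    using B I(3) LZ by (intro continuous_map_linear_combination T) auto
  \<comment> \<open>The coordinate topology is finer than the given one on the polytope.\<close>
  then have "continuous_map Z T (\<lambda>v. v)"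
    by (rule continuous_map_eq) (use L(2) KS Z in blast)
  then have id: "continuous_map Z (subtopology T K) (\<lambda>v. v)"
    using Z by (auto simp: continuous_map_in_subtopology)
  have wZ: "continuous_map Z euclideanreal (w i)" if "i \<in> I" for i
    using continuous_map_compose[OF id w(1)[OF that]] by (simp add: o_def)
  define p where "p x = (\<Sum>i\<in>I. w i x *\<^sub>R c i)" for x
  have pK: "p x \<in> K" if "x \<in> K" for x
    unfolding p_def K using w(2)[OF _ that] w(3)[OF that] I(1)
    by (intro convex_sum) (simp_all add: hull_inc)
  have Lp: "continuous_map Z euclideanreal (\<lambda>x. L b (p x))" for b
    unfolding p_def using I(1) wZ
    by (simp add: linear_sum[OF L(1)] linear_scale[OF L(1)]
        continuous_map_sum continuous_map_real_mult)
  define g where "g x y = - (\<Sum>b\<in>B. \<bar>L b y - L b (p x)\<bar>)" for x y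
  have fst: "continuous_map (prod_topology Z Z) euclideanreal (\<lambda>z. L b (p (fst z)))"
    and snd: "continuous_map (prod_topology Z Z) euclideanreal (\<lambda>z. L b (snd z))" for b
    using continuous_map_compose[OF continuous_map_fst Lp] continuous_map_compose[OF continuous_map_snd LZ]
    by (simp_all add: o_def)
  have "continuous_map (prod_topology Z Z) euclideanreal (\<lambda>z. g (fst z) (snd z))"
    unfolding g_def using B(1) fst snd
    by (intro continuous_map_minus continuous_map_sum continuous_map_real_abs continuous_map_diff)
  then have "pseudo_continuous (prod_topology Z Z) (\<lambda>(x, y). g x y)"
    by (simp add: case_prod_unfold continuous_imp_pseudo_continuous)
  moreover have "quasi_concave_on K (\<lambda>y. g x y)" for x
    unfolding quasi_concave_on_def
  proof (intro conjI allI)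
    show "convex K" unfolding K by simp
    have g_concave: "u * g x y + v * g x z \<le> g x (u *\<^sub>R y + v *\<^sub>R z)"
      if uv: "0 \<le> u" "0 \<le> v" "u + v = 1" for u v y z
    proof -
      have "\<bar>L b (u *\<^sub>R y + v *\<^sub>R z) - L b (p x)\<bar> \<le>
          u * \<bar>L b y - L b (p x)\<bar> + v * \<bar>L b z - L b (p x)\<bar>" for b
      proof -
        have "L b (u *\<^sub>R y + v *\<^sub>R z) - L b (p x) =
            u * L b y + v * L b z - (u + v) * L b (p x)"
          using uv by (simp add: linear_add[OF L(1)] linear_scale[OF L(1)])
        also have "\<dots> = u * (L b y - L b (p x)) + v * (L b z - L b (p x))"
          by (simp add: algebra_simps)
        also have "\<bar>\<dots>\<bar> \<le> \<bar>u * (L b y - L b (p x))\<bar> + \<bar>v * (L b z - L b (p x))\<bar>"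
          by (rule abs_triangle_ineq)
        finally show ?thesis using uv by (simp add: abs_mult)
      qed
      then have "(\<Sum>b\<in>B. \<bar>L b (u *\<^sub>R y + v *\<^sub>R z) - L b (p x)\<bar>) \<le>
          (\<Sum>b\<in>B. u * \<bar>L b y - L b (p x)\<bar> + v * \<bar>L b z - L b (p x)\<bar>)"
        by (intro sum_mono)
      then show ?thesis
        unfolding g_def by (simp add: sum_distrib_left sum.distrib)
    qed
    fix l
    show "convex {y \<in> K. l \<le> g x y}"
    proof (rule convexI; clarify; intro conjI)
      fix y z and u v :: real
      assume yz: "y \<in> K" "z \<in> K" "l \<le> g x y" "l \<le> g x z" and uv: "0 \<le> u" "0 \<le> v" "u + v = 1"
      show "u *\<^sub>R y + v *\<^sub>R z \<in> K"
        by (rule convexD[OF \<open>convex K\<close> yz(1,2) uv])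
      have "l = u * l + v * l" using uv by (metis distrib_right mult_1)
      also have "\<dots> \<le> u * g x y + v * g x z"
        using yz uv by (intro add_mono mult_left_mono)
      also have "\<dots> \<le> g x (u *\<^sub>R y + v *\<^sub>R z)"
        by (rule g_concave[OF uv])
      finally show "l \<le> g x (u *\<^sub>R y + v *\<^sub>R z)" .
    qed
  qed
  moreover have "K \<noteq> {}" "convex K" unfolding K using I by auto
  ultimately have "\<exists>M m d. (\<forall>x\<in>K. is_max_of (M x) (\<lambda>y. g x y) K) \<and> is_min_of m M K \<and>
      is_max_of d (\<lambda>x. g x x) K \<and> m \<le> d"
    unfolding Z_def by (intro minimax[OF T' \<open>Hausdorff_space T'\<close> _ \<open>compactin T' K\<close>]) simp_all
  then obtain M m d where Mmd: "\<forall>x\<in>K. is_max_of (M x) (\<lambda>y. g x y) K"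
      "is_min_of m M K" "is_max_of d (\<lambda>x. g x x) K" "m \<le> d"
    by (elim exE conjE)
  obtain x1 where "x1 \<in> K" "m = M x1"
    using Mmd(2) unfolding is_min_of_def by auto
  then have "g x1 (p x1) \<le> m"
    using Mmd(1) pK unfolding is_max_of_def by blast
  then have "0 \<le> m" unfolding g_def by simp
  moreover obtain x where x: "x \<in> K" "d = g x x"
    using Mmd(3) unfolding is_max_of_def by auto
  ultimately have "(\<Sum>b\<in>B. \<bar>L b x - L b (p x)\<bar>) \<le> 0"
    using Mmd(4) unfolding g_def by simp
  then have "(\<Sum>b\<in>B. \<bar>L b x - L b (p x)\<bar>) = 0"
    by (intro antisym sum_nonneg) simp_all
  then have "\<forall>b\<in>B. L b x = L b (p x)"
    using B(1) by (simp add: sum_nonneg_eq_0_iff)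
  then have "(\<Sum>b\<in>B. L b x *\<^sub>R b) = (\<Sum>b\<in>B. L b (p x) *\<^sub>R b)"
    by (intro sum.cong) simp_all
  then have "x = p x"
    using L(2)[OF subsetD[OF KS x(1)]] L(2)[OF subsetD[OF KS pK[OF x(1)]]] by simp
  then show ?thesis
    using x(1) unfolding p_def by blast
qed

section \<open>Ky Fan's inequality from fixed points\<close>

text \<open>Suppose that every \<open>x\<close> has some \<open>y\<close> with \<open>f x y > s\<close>, where \<open>s\<close> bounds \<open>f\<close> on the
  diagonal.  By lower semicontinuity one \<open>y\<close> serves a whole neighbourhood of \<open>x\<close>, so by compactness
  finitely many \<open>y\<close> suffice, and a partition of unity glues them to a continuous map of their
  convex hull into itself.  Its value at \<open>x\<close> is a convex combination of points \<open>y\<close> with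
  \<open>f x y > s\<close>, so at a fixed point quasi-concavity yields \<open>f x x > s\<close>, a contradiction.\<close>

lemma ky_fan_inequality:
  fixes f :: "'a::real_vector \<Rightarrow> 'a \<Rightarrow> real"
  assumes fixed_point: "\<And>(I :: 'a set) c w K.
      \<lbrakk>finite I; I \<noteq> {}; c ` I \<subseteq> topspace T; K = convex hull (c ` I);
       \<And>i. i \<in> I \<Longrightarrow> continuous_map (subtopology T K) euclideanreal (w i);
       \<And>i x. \<lbrakk>i \<in> I; x \<in> K\<rbrakk> \<Longrightarrow> (0::real) \<le> w i x; \<And>x. x \<in> K \<Longrightarrow> (\<Sum>i\<in>I. w i x) = 1\<rbrakk> \<Longrightarrow>
      \<exists>x\<in>K. x = (\<Sum>i\<in>I. w i x *\<^sub>R c i)"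
    and T: "Hausdorff_space T" and X: "X \<noteq> {}" "compactin T X" "convex X"
    and lsc: "\<forall>y\<in>X. lower_semicontinuous (subtopology T X) (\<lambda>x. f x y)"
    and qc: "\<forall>x\<in>X. quasi_concave_on X (\<lambda>y. f x y)"
  shows "\<exists>m. is_min_of m (\<lambda>x. SUP y\<in>X. ereal (f x y)) X \<and> m \<le> (SUP x\<in>X. ereal (f x x))"
proof -
  define Z where "Z = subtopology T X"
  have Z: "topspace Z = X" "compact_space Z"
    using X(2) compactin_subset_topspace unfolding Z_def
    by (fastforce, simp add: compact_space_subtopology)
  have open_above: "openin Z {x \<in> X. a < f x y}" if "y \<in> X" for a y
  proof (subst openin_subopen, clarify)
    fix x assume "x \<in> X" "a < f x y"
    then have "\<exists>V. openin Z V \<and> x \<in> V \<and> (\<forall>v\<in>V. a < f v y)"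
      using lsc[rule_format, OF that] Z(1) unfolding lower_semicontinuous_def Z_def by simp
    then obtain V where V: "openin Z V" "x \<in> V" "\<forall>v\<in>V. a < f v y" by (elim exE conjE)
    then have "V \<subseteq> {x \<in> X. a < f x y}"
      using openin_subset[OF V(1)] Z(1) by blast
    then show "\<exists>V. openin Z V \<and> x \<in> V \<and> V \<subseteq> {x \<in> X. a < f x y}"
      using V(1,2) by blast
  qed
  define \<phi> where "\<phi> x = (SUP y\<in>X. ereal (f x y))" for x
  have "\<exists>x\<in>topspace Z. \<forall>x'\<in>topspace Z. \<phi> x \<le> \<phi> x'"
  proof (rule compact_space_attains_least)
    fix x a assume xa: "x \<in> topspace Z" "a \<in> topspace Z" "\<phi> a < \<phi> x"
    then obtain y where y: "y \<in> X" "\<phi> a < ereal (f x y)"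
      unfolding \<phi>_def[of x] less_SUP_iff by blast
    have "ereal (f a y) \<le> \<phi> a"
      unfolding \<phi>_def using y(1) by (rule SUP_upper)
    \<comment> \<open>An extended real squeezed between two reals is real, so that \<open>open_above\<close> applies to it.\<close>
    with y(2) obtain r where r: "\<phi> a = ereal r"
      by (cases "\<phi> a") simp_all
    have "\<phi> a < \<phi> v" if "r < f v y" for v
      unfolding \<phi>_def[of v] r less_SUP_iff using y(1) that by auto
    then show "\<exists>V. openin Z V \<and> x \<in> V \<and> (\<forall>v\<in>V. \<phi> a < \<phi> v)"
      using open_above[OF y(1), of r] xa(1) y(2) r Z(1)
      by (intro exI[of _ "{x \<in> X. r < f x y}"]) simp
  qed (simp_all add: Z X(1))
  then obtain x0 where x0: "x0 \<in> X" "\<And>x. x \<in> X \<Longrightarrow> \<phi> x0 \<le> \<phi> x"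
    using Z(1) by auto
  define D where "D = (SUP x\<in>X. ereal (f x x))"
  have "\<phi> x0 \<le> D"
  proof (rule ccontr)
    assume "\<not> \<phi> x0 \<le> D"
    then have "D < \<phi> x" if "x \<in> X" for x
      using x0(2)[OF that] by (meson not_le less_le_trans)
    then have "\<forall>x\<in>X. \<exists>y. y \<in> X \<and> D < ereal (f x y)"
      unfolding \<phi>_def less_SUP_iff by blast
    from bchoice[OF this] obtain c where "\<forall>x\<in>X. c x \<in> X \<and> D < ereal (f x (c x))" ..
    then have c: "c x \<in> X" "D < ereal (f x (c x))" if "x \<in> X" for x
      using that by simp_all
    have diag: "ereal (f x x) \<le> D" if "x \<in> X" for x
      unfolding D_def using that by (rule SUP_upper)
    then obtain s where s: "D = ereal s"
      using c(2)[OF x0(1)] diag[OF x0(1)] by (cases D) simp_all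
    have "completely_regular_space Z"
      using T Z(2) unfolding Z_def
      by (simp add: Hausdorff_space_subtopology compact_Hausdorff_or_regular_imp_normal_space
          normal_imp_completely_regular_space)
    \<comment> \<open>Bumps at \<open>z\<close> inside \<open>{x. s < f x (c z)}\<close>: below, \<open>1 - k z\<close> is truncated at \<open>0\<close>.\<close>
    have "\<exists>k. continuous_map Z euclideanreal k \<and> k z = 0 \<and>
        (\<forall>x\<in>X. k x \<noteq> 1 \<longrightarrow> s < f x (c z))" if z: "z \<in> X" for z
    proof -
      have "z \<in> {x \<in> X. s < f x (c z)}" using c(2)[OF z] s z by simp
      then obtain k where "continuous_map Z euclideanreal k" "k z = 0"
          "k ` (topspace Z - {x \<in> X. s < f x (c z)}) \<subseteq> {1}"
        using \<open>completely_regular_space Z\<close> open_above[OF c(1)[OF z], of s]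
        unfolding completely_regular_space_alt' by meson
      then show ?thesis using Z(1) by (intro exI[of _ k]) auto
    qed
    then have "\<forall>z\<in>X. \<exists>k. continuous_map Z euclideanreal k \<and> k z = 0 \<and>
        (\<forall>x\<in>X. k x \<noteq> 1 \<longrightarrow> s < f x (c z))" ..
    from bchoice[OF this] obtain k where "\<forall>z\<in>X. continuous_map Z euclideanreal (k z) \<and> k z z = 0 \<and>
        (\<forall>x\<in>X. k z x \<noteq> 1 \<longrightarrow> s < f x (c z))" ..
    then have k: "\<And>z. z \<in> X \<Longrightarrow> continuous_map Z euclideanreal (k z)"
        "\<And>z. z \<in> X \<Longrightarrow> k z z = 0"
        "\<And>z x. \<lbrakk>z \<in> X; x \<in> X; k z x \<noteq> 1\<rbrakk> \<Longrightarrow> s < f x (c z)"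
      by simp_all
    define h where "h z x = max 0 (1 - k z x)" for z x
    have h_cont: "continuous_map Z euclideanreal (h z)" if "z \<in> X" for z
      unfolding h_def using k(1)[OF that]
      by (intro continuous_map_real_max continuous_map_diff) simp_all
    have h_nonneg: "0 \<le> h z x" for z x
      unfolding h_def by simp
    define U where "U z = {x \<in> X. 0 < h z x}" for z
    have "openin Z (U z)" if "z \<in> X" for z
      using openin_continuous_map_preimage[OF h_cont[OF that], of "{0<..}"] Z(1)
      unfolding U_def by simp
    then have "\<forall>V\<in>U ` X. openin Z V" by blast
    moreover have "topspace Z \<subseteq> \<Union>(U ` X)"
      unfolding Z(1) U_def h_def using k(2) by force
    ultimately obtain \<F> where "finite \<F>" "\<F> \<subseteq> U ` X" "topspace Z \<subseteq> \<Union>\<F>"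
      using Z(2) unfolding compact_space_alt by meson
    then obtain I where I: "finite I" "I \<subseteq> X" "X \<subseteq> \<Union>(U ` I)"
      using finite_subset_image[of \<F> U X] Z(1) by blast
    have pos: "0 < (\<Sum>z\<in>I. h z x)" if x: "x \<in> X" for x
    proof -
      obtain z where "z \<in> I" "0 < h z x" using I(3) x unfolding U_def by blast
      then show ?thesis using I(1) h_nonneg by (intro sum_pos2)
    qed
    define K where "K = convex hull (c ` I)"
    have KX: "K \<subseteq> X"
      unfolding K_def using X(3) c(1) I(2) by (intro hull_minimal) blast+
    define w where "w z x = h z x / (\<Sum>z\<in>I. h z x)" for z x
    have "\<exists>x\<in>K. x = (\<Sum>z\<in>I. w z x *\<^sub>R c z)"
    proof (rule fixed_point)
      show "I \<noteq> {}" using I(3) X(1) by blast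
      show "c ` I \<subseteq> topspace T"
        using c(1) I(2) compactin_subset_topspace[OF X(2)] by blast
      show "continuous_map (subtopology T K) euclideanreal (w z)" if "z \<in> I" for z
      proof -
        have "continuous_map Z euclideanreal (w z)"
          unfolding w_def
        proof (intro continuous_map_real_divide continuous_map_sum)
          show "(\<Sum>z\<in>I. h z x) \<noteq> 0" if "x \<in> topspace Z" for x
            using pos[of x] that Z(1) by simp
        qed (use that I(1,2) h_cont in blast)+
        then have "continuous_map (subtopology Z K) euclideanreal (w z)"
          by (rule continuous_map_from_subtopology)
        then show ?thesis
          unfolding Z_def using KX by (simp add: subtopology_subtopology Int_absorb1)
      qed
      show "0 \<le> w z x" for z x
        unfolding w_def using h_nonneg by (simp add: sum_nonneg)
      show "(\<Sum>z\<in>I. w z x) = 1" if "x \<in> K" for x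
        using pos[of x] subsetD[OF KX that] unfolding w_def sum_divide_distrib[symmetric] by simp
    qed (simp_all add: I(1) K_def)
    then obtain x where x: "x \<in> K" "x = (\<Sum>z\<in>I. w z x *\<^sub>R c z)" by blast
    then have xX: "x \<in> X" using KX by auto
    \<comment> \<open>Only points with non-zero weight at \<open>x\<close> are known to satisfy \<open>s < f x (c z)\<close>.\<close>
    define J where "J = {z \<in> I. w z x \<noteq> 0}"
    have IJ: "finite I" "J \<subseteq> I" "\<forall>z\<in>I - J. w z x = 0"
      unfolding J_def using I(1) by blast+
    have "(\<Sum>z\<in>J. w z x *\<^sub>R c z) \<in> {y \<in> X. s < f x y}"
    proof (rule convex_sum)
      show "finite J" using IJ finite_subset by blast
      show "convex {y \<in> X. s < f x y}"
        using qc xX by (intro convex_strict_superlevel) blast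
      have "(\<Sum>z\<in>J. w z x) = (\<Sum>z\<in>I. w z x)"
        using IJ by (rule sum.mono_neutral_left)
      then show "(\<Sum>z\<in>J. w z x) = 1"
        using pos[OF xX] by (simp add: w_def sum_divide_distrib[symmetric])
      show "0 \<le> w z x" for z
        unfolding w_def using h_nonneg by (simp add: sum_nonneg)
      show "c z \<in> {y \<in> X. s < f x y}" if "z \<in> J" for z
      proof -
        have z: "z \<in> X" "h z x \<noteq> 0" using that I(2) unfolding J_def w_def by auto
        then have "k z x \<noteq> 1" unfolding h_def by auto
        then show ?thesis using k(3)[OF z(1) xX] c(1)[OF z(1)] by simp
      qed
    qed
    moreover have "(\<Sum>z\<in>J. w z x *\<^sub>R c z) = (\<Sum>z\<in>I. w z x *\<^sub>R c z)"
      using IJ by (intro sum.mono_neutral_left) auto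
    then have "(\<Sum>z\<in>J. w z x *\<^sub>R c z) = x"
      using x(2) by simp
    ultimately show False
      using diag[OF xX] s by simp
  qed
  then show ?thesis
    using x0 unfolding is_min_of_def \<phi>_def D_def by blast
qed

theorem proposition4p5:
  shows
   "(\<forall>(T :: 'a::real_vector topology) X (f :: 'a \<Rightarrow> 'a \<Rightarrow> real).
       topological_vector_space T \<and> Hausdorff_space T \<and>
       X \<noteq> {} \<and> compactin T X \<and> convex X \<and>
       (\<forall>y\<in>X. lower_semicontinuous (subtopology T X) (\<lambda>x. f x y)) \<and>
       (\<forall>x\<in>X. quasi_concave_on X (\<lambda>y. f x y)) \<longrightarrow>
       (\<exists>m. is_min_of m (\<lambda>x. SUP y\<in>X. ereal (f x y)) X \<and>
            m \<le> (SUP x\<in>X. ereal (f x x))))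
    \<longleftrightarrow>
    (\<forall>(T :: 'a topology) X (f :: 'a \<Rightarrow> 'a \<Rightarrow> real).
       topological_vector_space T \<and> Hausdorff_space T \<and>
       X \<noteq> {} \<and> compactin T X \<and> convex X \<and>
       pseudo_continuous (prod_topology (subtopology T X) (subtopology T X)) (\<lambda>(x, y). f x y) \<and>
       (\<forall>x\<in>X. quasi_concave_on X (\<lambda>y. f x y)) \<longrightarrow>
       (\<exists>M m d. (\<forall>x\<in>X. is_max_of (M x) (\<lambda>y. f x y) X) \<and>
                is_min_of m M X \<and>
                is_max_of d (\<lambda>x. f x x) X \<and>
                m \<le> d))"
  (is "?A \<longleftrightarrow> ?B")
proof
  assume A: ?A
  show ?B
  proof (intro allI impI; elim conjE)
    fix T :: "'a topology" and X and f :: "'a \<Rightarrow> 'a \<Rightarrow> real"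
    assume H: "topological_vector_space T" "Hausdorff_space T" "X \<noteq> {}" "compactin T X" "convex X"
      "pseudo_continuous (prod_topology (subtopology T X) (subtopology T X)) (\<lambda>(x, y). f x y)"
      "\<forall>x\<in>X. quasi_concave_on X (f x)"
    show "\<exists>M m d. (\<forall>x\<in>X. is_max_of (M x) (f x) X) \<and> is_min_of m M X \<and>
                  is_max_of d (\<lambda>x. f x x) X \<and> m \<le> d"
      by (rule pseudo_continuous_minimax[OF A[rule_format, OF conjI[OF H(1) conjI[OF H(2)
              conjI[OF H(3) conjI[OF H(4) conjI[OF H(5) conjI]]]]]] H(3,4,6,7)])
  qed
next
  assume B: ?B
  show ?A
  proof (intro allI impI; elim conjE)
    fix T :: "'a topology" and X and f :: "'a \<Rightarrow> 'a \<Rightarrow> real"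
    assume H: "topological_vector_space T" "Hausdorff_space T" "X \<noteq> {}" "compactin T X" "convex X"
      "\<forall>y\<in>X. lower_semicontinuous (subtopology T X) (\<lambda>x. f x y)"
      "\<forall>x\<in>X. quasi_concave_on X (f x)"
    show "\<exists>m. is_min_of m (\<lambda>x. SUP y\<in>X. ereal (f x y)) X \<and> m \<le> (SUP x\<in>X. ereal (f x x))"
    proof (rule ky_fan_inequality[OF _ H(2-7)])
      fix I :: "'a set" and c :: "'a \<Rightarrow> 'a" and w :: "'a \<Rightarrow> 'a \<Rightarrow> real" and K
      assume "finite I" "I \<noteq> {}" "c ` I \<subseteq> topspace T" "K = convex hull (c ` I)"
        "\<And>i. i \<in> I \<Longrightarrow> continuous_map (subtopology T K) euclideanreal (w i)"
        "\<And>i x. \<lbrakk>i \<in> I; x \<in> K\<rbrakk> \<Longrightarrow> 0 \<le> w i x" "\<And>x. x \<in> K \<Longrightarrow> (\<Sum>i\<in>I. w i x) = 1"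
      with H(1) show "\<exists>x\<in>K. x = (\<Sum>i\<in>I. w i x *\<^sub>R c i)"
        using B[rule_format, OF conjI[OF _ conjI[OF _ conjI[OF _ conjI[OF _ conjI[OF _ conjI]]]]]]
        by (intro polytope_fixed_point)
    qed
  qed
qed

end
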